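(* Fix constants $c,c_1,c_2,C,\kappa>0$, a sequence of positive integers $(D_n)_{n\in\mathbb N}$ with $D_n=\omega(1)$, and a sequence of positive numbers $(B_n)_{n\in\mathbb N}$ with $B_n=\omega(\max\{n^{-C},e^{-CD_n}\})$. For each $n$ let $P_0=P_0^{(n)}$ be a discrete prior on $\mathbb R^n$, let $X,X'$ be i.i.d. from $P_0$, let $\mathbb P(\langle X,X'\rangle=t)$ denote the probability mass function of the overlap and $\mathcal S_{\mathrm{ov}}=\{q\in\mathbb R:\mathbb P(\langle X,X'\rangle=q)>0\}$. Let $a_n:\mathcal S_{\mathrm{ov}}\to\mathbb R_{>0}$ be functions such that $q+a_n(q)\in\mathcal S_{\mathrm{ov}}$ for all $q\in\mathcal S_{\mathrm{ov}}$. Assume: (1) for all $D>0$, $c_1B_nD^\kappa\le q(D)\le c_2B_nD^\kappa$; (2) $\displaystyle\mathbf\Delta_{a_n}\log\mathbb P(\langle X,X'\rangle=t)\Big|_{t=q(D_n)}\le-\frac{c}{q(D_n)}$. Then there exists a constant $C'>0$ such that for any $u>0$ satisfying $u+\mathbf\Delta_{a_n}\mathcal F_{\mathrm{ann},u}\big|_{q=q(D_n)}>0$ we have $$\big(\mathrm{Corr}^{\le D_n}_{P_0}\big)^2\!\left(u+\mathbf\Delta_{a_n}\mathcal F_{\mathrm{ann},u}\Big|_{q=q(D_n)}\right)\ge\frac{C'}{D_n^{2\kappa}}\,q(D_n).$$ In particular, for any SNR $\lambda>0$, $\big(\mathrm{Corr}^{\le D_n}_{P_0}\big)^2(\lambda)\le\frac{C'}{D_n^{2\kappa}}q(D_n)$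 implies $\mathbf\Delta_{a_n}\mathcal F_{\mathrm{ann},\lambda}\big|_{q=q(D_n)}\ge0$.
   Context: Gaussian additive model (GAM) with prior $P_0$ on $\mathbb R^n$ and signal-to-noise ratio (SNR) $\lambda>0$: one observes $Y=\sqrt\lambda X+Z$ with $X\sim P_0$ and independent $Z\sim N(0,I_n)$. Low-degree correlation: $\mathbb R[Y]_{\le D}$ is the space of polynomials in $Y$ of total degree at most $D$, and $$\mathrm{Corr}^{\le D}_{P_0}(\lambda):=\sqrt{\sum_{i=1}^n\ \sup_{g_i\in\mathbb R[Y]_{\le D},\ \mathbb E[g_i(Y)^2]=1}\mathbb E[g_i(Y)X_i]^2}.$$ $(\mathrm{Corr}^{\le D}_{P_0})^2(\lambda)$ denotes its square. Overlap quantile: for $D>0$, $q(D):=\inf\{y\in\mathbb R:\ \mathbb P(|\langle X,X'\rangle|\le y)\ge 1-e^{-D}\}$. Annealed Franz–Parisi potential (discrete case): for $q\in\mathcal S_{\mathrm{ov}}$, $\mathcal F_{\mathrm{ann},\lambda}(q):=-\log\mathbb E_{X,X'}\big[1_{\langle X,X'\rangle=q}\,e^{\lambda\langle X,X'\rangle}\big]=-\lambda q-\log\mathbb P(\langle X,X'\rangle=q)$. Discrete derivative: for $f:\mathcal S_{\mathrm{ov}}\to\mathbb R$ and $q\in\mathcal S_{\mathrm{ov}}$, $\mathbf\Delta_{a_n}(f)(q)=\dfrac{f(q+a_n(q))-f(q)}{a_n(q)}$. *)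

theory Defs
  imports "HOL-Probability.Probability" "HOL-Library.Landau_Symbols"
begin

text \<open>
  The dimension \<open>n\<close> varies inside the statement, so a point of \<open>\<real>\<^sup>n\<close> is a function of type
  \<open>nat \<Rightarrow> real\<close> that is extensional on \<open>{..<n}\<close> (the carrier of \<open>Pi\<^sub>M {..<n} (\<lambda>_. borel)\<close>).
  A discrete prior is a \<open>pmf\<close>; its support is countable, but may be infinite.
\<close>

definition Rn :: "nat \<Rightarrow> (nat \<Rightarrow> real) set" where
  "Rn n = {..<n} \<rightarrow>\<^sub>E UNIV"

definition inner_n :: "nat \<Rightarrow> (nat \<Rightarrow> real) \<Rightarrow> (nat \<Rightarrow> real) \<Rightarrow> real" where
  "inner_n n x y = (\<Sum>i<n. x i * y i)"

definition std_gaussian :: "nat \<Rightarrow> (nat \<Rightarrow> real) measure" where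
  "std_gaussian n = Pi\<^sub>M {..<n} (\<lambda>_. density lborel (\<lambda>x. ennreal (std_normal_density x)))"

definition gam_obs :: "nat \<Rightarrow> real \<Rightarrow> (nat \<Rightarrow> real) \<Rightarrow> (nat \<Rightarrow> real) \<Rightarrow> nat \<Rightarrow> real" where
  "gam_obs n lam x z = (\<lambda>i\<in>{..<n}. sqrt lam * x i + z i)"

text \<open>\<open>gam_expectation n P lam h\<close> is \<open>E[h X Y]\<close> for \<open>X\<close> distributed according to \<open>P\<close>.\<close>

definition gam_expectation ::
  "nat \<Rightarrow> (nat \<Rightarrow> real) pmf \<Rightarrow> real \<Rightarrow> ((nat \<Rightarrow> real) \<Rightarrow> (nat \<Rightarrow> real) \<Rightarrow> real) \<Rightarrow> real" where
  "gam_expectation n P lam h =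
     (\<integral>(x, z). h x (gam_obs n lam x z) \<partial>(measure_pmf P \<Otimes>\<^sub>M std_gaussian n))"

definition multi_indices :: "nat \<Rightarrow> nat \<Rightarrow> (nat \<Rightarrow> nat) set" where
  "multi_indices n D = {\<alpha> \<in> {..<n} \<rightarrow>\<^sub>E UNIV. (\<Sum>i<n. \<alpha> i) \<le> D}"

lemma finite_multi_indices: "finite (multi_indices n D)"
proof (rule finite_subset)
  show "multi_indices n D \<subseteq> {..<n} \<rightarrow>\<^sub>E {..D}"
  proof
    fix \<alpha> assume a: "\<alpha> \<in> multi_indices n D"
    have "\<alpha> i \<le> D" if "i < n" for i
      using a member_le_sum[of i "{..<n}" \<alpha>] that by (auto simp: multi_indices_def)
    with a show "\<alpha> \<in> {..<n} \<rightarrow>\<^sub>E {..D}"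
      by (auto simp: multi_indices_def PiE_iff)
  qed
  show "finite ({..<n} \<rightarrow>\<^sub>E {..D})"
    by (intro finite_PiE) auto
qed

text \<open>Polynomial functions in \<open>y 0, \<dots>, y (n - 1)\<close> of total degree at most \<open>D\<close>.\<close>

definition poly_le :: "nat \<Rightarrow> nat \<Rightarrow> ((nat \<Rightarrow> real) \<Rightarrow> real) set" where
  "poly_le n D =
     range (\<lambda>coef y. \<Sum>\<alpha>\<in>multi_indices n D. coef \<alpha> * (\<Prod>i<n. y i ^ \<alpha> i))"

text \<open>
  The supremum is taken in \<open>real\<close>. If \<open>X i\<close> has a finite second moment, then the set is bounded by
  \<open>E[(X i)\<^sup>2]\<close> (Cauchy-Schwarz) and contains the value at \<open>g = 1\<close>. The constraint
  \<open>E[g(Y)\<^sup>2] = 1\<close> can only hold for square-integrable \<open>g(Y)\<close>, since the integral of a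
  non-integrable function is 0.
\<close>

definition low_degree_corr :: "nat \<Rightarrow> (nat \<Rightarrow> real) pmf \<Rightarrow> nat \<Rightarrow> real \<Rightarrow> real" where
  "low_degree_corr n P D lam =
     sqrt (\<Sum>i<n. SUP g\<in>{g \<in> poly_le n D. gam_expectation n P lam (\<lambda>x y. (g y)\<^sup>2) = 1}.
             (gam_expectation n P lam (\<lambda>x y. g y * x i))\<^sup>2)"

definition overlap_pmf :: "nat \<Rightarrow> (nat \<Rightarrow> real) pmf \<Rightarrow> real pmf" where
  "overlap_pmf n P = map_pmf (\<lambda>(x, x'). inner_n n x x') (pair_pmf P P)"

definition S_ov :: "nat \<Rightarrow> (nat \<Rightarrow> real) pmf \<Rightarrow> real set" where
  "S_ov n P = {q. pmf (overlap_pmf n P) q > 0}"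

definition overlap_quantile :: "nat \<Rightarrow> (nat \<Rightarrow> real) pmf \<Rightarrow> real \<Rightarrow> real" where
  "overlap_quantile n P D =
     Inf {y. measure_pmf.prob (overlap_pmf n P) {t. \<bar>t\<bar> \<le> y} \<ge> 1 - exp (- D)}"

definition F_ann :: "nat \<Rightarrow> (nat \<Rightarrow> real) pmf \<Rightarrow> real \<Rightarrow> real \<Rightarrow> real" where
  "F_ann n P lam q =
     - ln (measure_pmf.expectation (pair_pmf P P)
             (\<lambda>(x, x'). indicator {q} (inner_n n x x') * exp (lam * inner_n n x x')))"

definition discrete_deriv :: "(real \<Rightarrow> real) \<Rightarrow> (real \<Rightarrow> real) \<Rightarrow> real \<Rightarrow> real" where
  "discrete_deriv a f q = (f (q + a q) - f q) / a q"

end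

theory Submission
  imports Defs "HOL-Real_Asymp.Real_Asymp"
begin

text \<open>
  The shift by \<open>u\<close> cancels the linear part of the potential, so the SNR in question does not depend
  on \<open>u\<close>: it is minus the discrete derivative of the log-mass of the overlap, hence at least
  \<open>c / q(D)\<close>. At such an SNR linear estimators suffice. With \<open>M = E[X X\<^sup>T]\<close> and \<open>F\<close> its Frobenius
  norm, \<open>g\<^sub>i(Y) = \<langle>M e\<^sub>i, Y\<rangle>\<close> has \<open>E[g\<^sub>i X\<^sub>i] = \<surd>\<lambda> |M e\<^sub>i|\<^sup>2\<close> and \<open>E[g\<^sub>i\<^sup>2] \<le> |M e\<^sub>i|\<^sup>2 (1 + \<lambda> F)\<close>, which gives
  \<open>Corr\<^sup>2 \<ge> \<lambda> F\<^sup>2 / (1 + \<lambda> F)\<close>. Since \<open>F\<^sup>2 = E[\<langle>X, X'\<rangle>\<^sup>2]\<close>, the lower bound on the quantile \<open>q(1)\<close>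
  yields \<open>F \<ge> const \<cdot> B\<close>; inserting \<open>\<lambda> \<ge> c / (c\<^sub>2 B D\<^sup>\<kappa>)\<close> gives a bound of order \<open>B / D\<^sup>\<kappa>\<close>, which is the
  order of \<open>q(D) / D\<^sup>2\<^sup>\<kappa>\<close>. The upper bounds on the quantiles make the second moments finite.
\<close>

subsection \<open>Integrals of products and quadratic forms\<close>

text \<open>Everything comes from squares being nonnegative:
  \<open>2 * \<bar>f x\<bar> * \<bar>g x\<bar>\<close> is dominated by the sum of the squares, which
  gives integrability, and the integral of \<open>(s * f x - t * g x)^2\<close> is a nonnegative
  quadratic form in \<open>s\<close> and \<open>t\<close>.\<close>

lemma integral_Cauchy_Schwarz:
  fixes f g :: "'a \<Rightarrow> real"
  assumes [measurable]: "f \<in> borel_measurable M" "g \<in> borel_measurable M"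
    and f: "integrable M (\<lambda>x. (f x)\<^sup>2)" and g: "integrable M (\<lambda>x. (g x)\<^sup>2)"
  shows "integrable M (\<lambda>x. f x * g x)"
    and "(\<integral>x. f x * g x \<partial>M)\<^sup>2 \<le> (\<integral>x. (f x)\<^sup>2 \<partial>M) * (\<integral>x. (g x)\<^sup>2 \<partial>M)"
proof -
  show fg: "integrable M (\<lambda>x. f x * g x)"
  proof (rule Bochner_Integration.integrable_bound)
    show "integrable M (\<lambda>x. (f x)\<^sup>2 + (g x)\<^sup>2)" using f g by simp
    show "AE x in M. norm (f x * g x) \<le> norm ((f x)\<^sup>2 + (g x)\<^sup>2)"
    proof (rule AE_I2)
      fix x
      have "2 * (\<bar>f x\<bar> * \<bar>g x\<bar>) \<le> (f x)\<^sup>2 + (g x)\<^sup>2"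
        using zero_le_power2[of "\<bar>f x\<bar> - \<bar>g x\<bar>"] by (simp add: power2_diff)
      moreover have "0 \<le> \<bar>f x\<bar> * \<bar>g x\<bar>" by simp
      ultimately have "\<bar>f x\<bar> * \<bar>g x\<bar> \<le> (f x)\<^sup>2 + (g x)\<^sup>2" by linarith
      then show "norm (f x * g x) \<le> norm ((f x)\<^sup>2 + (g x)\<^sup>2)" by (simp add: abs_mult)
    qed
  qed simp
  define A B C where "A = (\<integral>x. (f x)\<^sup>2 \<partial>M)" and "B = (\<integral>x. f x * g x \<partial>M)" and "C = (\<integral>x. (g x)\<^sup>2 \<partial>M)"
  have quad: "0 \<le> s\<^sup>2 * A - 2 * s * t * B + t\<^sup>2 * C" for s t
  proof -
    have "0 \<le> (\<integral>x. (s * f x - t * g x)\<^sup>2 \<partial>M)" by simp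
    also have "\<dots> = (\<integral>x. s\<^sup>2 * (f x)\<^sup>2 - 2 * s * t * (f x * g x) + t\<^sup>2 * (g x)\<^sup>2 \<partial>M)"
      by (simp add: power2_diff power_mult_distrib algebra_simps)
    also have "\<dots> = s\<^sup>2 * A - 2 * s * t * B + t\<^sup>2 * C"
      unfolding A_def B_def C_def using f g fg by simp
    finally show ?thesis .
  qed
  have "A \<ge> 0" "C \<ge> 0" by (auto simp: A_def C_def)
  have "B\<^sup>2 \<le> A * C"
  proof (cases "A = 0")
    case True
    have "B = 0"
    proof (rule ccontr)
      assume "B \<noteq> 0"
      \<comment> \<open>With \<open>A = 0\<close> the form is linear in \<open>s\<close>; this
        choice of \<open>s\<close> makes its value \<open>-1\<close>.\<close>
      with quad[of "(C + 1) / (2 * B)" 1] True show False by (simp add: field_simps)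
    qed
    with True show ?thesis by simp
  next
    case False
    with \<open>A \<ge> 0\<close> have "A > 0" by simp
    \<comment> \<open>The choice \<open>s = B\<close>, \<open>t = A\<close> turns the form into
      \<open>A\<close> times the discriminant.\<close>
    with quad[of B A] have "0 \<le> A * (A * C - B\<^sup>2)" by (simp add: power2_eq_square algebra_simps)
    with \<open>A > 0\<close> show ?thesis by (simp add: zero_le_mult_iff)
  qed
  then show "(\<integral>x. f x * g x \<partial>M)\<^sup>2 \<le> (\<integral>x. (f x)\<^sup>2 \<partial>M) * (\<integral>x. (g x)\<^sup>2 \<partial>M)"
    by (simp add: A_def B_def C_def)
qed

lemma (in pair_sigma_finite) integral_mult_prod:
  fixes f :: "'a \<Rightarrow> real" and g :: "'b \<Rightarrow> real"
  assumes f: "integrable M1 f" and g: "integrable M2 g"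
  shows "integrable (M1 \<Otimes>\<^sub>M M2) (\<lambda>(x, y). f x * g y)"
    and "(\<integral>(x, y). f x * g y \<partial>(M1 \<Otimes>\<^sub>M M2)) = (\<integral>x. f x \<partial>M1) * (\<integral>y. g y \<partial>M2)"
proof -
  have [measurable]: "f \<in> borel_measurable M1" "g \<in> borel_measurable M2" using f g by auto
  show i: "integrable (M1 \<Otimes>\<^sub>M M2) (\<lambda>(x, y). f x * g y)"
    by (rule Fubini_integrable) (use f g in \<open>auto simp: abs_mult\<close>)
  show "(\<integral>(x, y). f x * g y \<partial>(M1 \<Otimes>\<^sub>M M2)) = (\<integral>x. f x \<partial>M1) * (\<integral>y. g y \<partial>M2)"
    using integral_fst'[OF i] by simp
qed

text \<open>Reduces integrability to a uniform bound on finite partial sums, the form in which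
  finiteness of the second moments of the prior is proved.\<close>

lemma integrable_measure_pmf_iff_abs_summable:
  fixes f :: "'a \<Rightarrow> real"
  shows "integrable (measure_pmf p) f \<longleftrightarrow> Infinite_Set_Sum.abs_summable_on (\<lambda>x. pmf p x * f x) UNIV"
  unfolding abs_summable_on_def measure_pmf_eq_density
  by (subst integrable_density) auto

text \<open>The underlying types may be uncountable, so the product sigma-algebra may be coarser
  than the power set carrying \<open>pair_pmf p q\<close>. The two measures agree on the coarser one
  and the integrand is measurable there, so Fubini transfers.\<close>

lemma expectation_pair_pmf_mult:
  fixes f :: "'a \<Rightarrow> real" and g :: "'b \<Rightarrow> real"
  assumes "integrable (measure_pmf p) f" and "integrable (measure_pmf q) g"
  shows "integrable (measure_pmf (pair_pmf p q)) (\<lambda>(x, y). f x * g y)"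
    and "measure_pmf.expectation (pair_pmf p q) (\<lambda>(x, y). f x * g y)
           = measure_pmf.expectation p f * measure_pmf.expectation q g"
proof -
  interpret pair_sigma_finite "measure_pmf p" "measure_pmf q" ..
  let ?N = "measure_pmf p \<Otimes>\<^sub>M measure_pmf q" and ?M = "measure_pmf (pair_pmf p q)"
  note prod = integral_mult_prod[OF assms]
  have meas: "(\<lambda>(x, y). f x * g y) \<in> borel_measurable ?N"
    using prod(1) by (rule borel_measurable_integrable)
  have sub: "sets ?N \<subseteq> sets ?M" "space ?N = space ?M"
    by (auto simp: space_pair_measure)
  have eq: "emeasure ?N X = emeasure ?M X" if "X \<in> sets ?N" for X
  proof -
    have "emeasure ?N X = (\<integral>\<^sup>+x. \<integral>\<^sup>+y. indicator X (x, y) \<partial>q \<partial>p)"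
      using that by (rule measure_pmf.emeasure_pair_measure)
    also have "\<dots> = (\<integral>\<^sup>+z. indicator X z \<partial>?M)"
      by (rule nn_integral_pair_pmf'[symmetric])
    finally show ?thesis by simp
  qed
  show "integrable ?M (\<lambda>(x, y). f x * g y)"
    using prod(1) integrable_subalgebra[OF meas sub eq] by blast
  show "integral\<^sup>L ?M (\<lambda>(x, y). f x * g y)
           = measure_pmf.expectation p f * measure_pmf.expectation q g"
    using prod(2) integral_subalgebra[OF meas sub eq] by simp
qed

lemma integral_linear_form:
  fixes f :: "nat \<Rightarrow> 'a \<Rightarrow> real"
  assumes "\<And>j. j < n \<Longrightarrow> integrable M (f j)"
  shows "integrable M (\<lambda>x. \<Sum>j<n. v j * f j x)"
    and "(\<integral>x. (\<Sum>j<n. v j * f j x) \<partial>M) = (\<Sum>j<n. v j * (\<integral>x. f j x \<partial>M))"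
proof -
  have i: "integrable M (\<lambda>x. v j * f j x)" if "j \<in> {..<n}" for j
    using assms that by (intro Bochner_Integration.integrable_mult_right) blast
  then show "integrable M (\<lambda>x. \<Sum>j<n. v j * f j x)"
    by (rule Bochner_Integration.integrable_sum)
  have "(\<integral>x. (\<Sum>j<n. v j * f j x) \<partial>M) = (\<Sum>j<n. \<integral>x. v j * f j x \<partial>M)"
    using i by (rule Bochner_Integration.integral_sum)
  then show "(\<integral>x. (\<Sum>j<n. v j * f j x) \<partial>M) = (\<Sum>j<n. v j * (\<integral>x. f j x \<partial>M))"
    by simp
qed

lemma integral_quadratic_form:
  fixes f :: "nat \<Rightarrow> 'a \<Rightarrow> real"
  assumes "\<And>j k. j < n \<Longrightarrow> k < n \<Longrightarrow> integrable M (\<lambda>x. f j x * f k x)"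
  shows "integrable M (\<lambda>x. (\<Sum>j<n. v j * f j x)\<^sup>2)"
    and "(\<integral>x. (\<Sum>j<n. v j * f j x)\<^sup>2 \<partial>M)
      = (\<Sum>j<n. \<Sum>k<n. v j * v k * (\<integral>x. f j x * f k x \<partial>M))"
proof -
  \<comment> \<open>The square is a linear form whose terms contain linear forms, so
    \<open>integral_linear_form\<close> can be applied twice.\<close>
  have eq: "(\<Sum>j<n. v j * f j x)\<^sup>2 = (\<Sum>j<n. v j * (\<Sum>k<n. v k * (f j x * f k x)))" for x
    unfolding power2_eq_square sum_product by (simp add: mult_ac sum_distrib_left)
  have inner: "integrable M (\<lambda>x. \<Sum>k<n. v k * (f j x * f k x))"
    "(\<integral>x. (\<Sum>k<n. v k * (f j x * f k x)) \<partial>M) = (\<Sum>k<n. v k * (\<integral>x. f j x * f k x \<partial>M))"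
    if "j < n" for j
    using integral_linear_form[of n M "\<lambda>k x. f j x * f k x" v] assms[OF that] by blast+
  show "integrable M (\<lambda>x. (\<Sum>j<n. v j * f j x)\<^sup>2)"
    unfolding eq using inner(1) by (rule integral_linear_form)
  show "(\<integral>x. (\<Sum>j<n. v j * f j x)\<^sup>2 \<partial>M)
      = (\<Sum>j<n. \<Sum>k<n. v j * v k * (\<integral>x. f j x * f k x \<partial>M))"
    unfolding eq using integral_linear_form(2)[of n M "\<lambda>j x. \<Sum>k<n. v k * (f j x * f k x)" v, OF inner(1)]
    by (simp add: inner(2) sum_distrib_left mult_ac)
qed

subsection \<open>Overlap moments and quantiles\<close>

text \<open>Separates the two replicas: each summand is a function of \<open>x\<close> times the
  same function of \<open>y\<close>, so under independence its mean is the square of an entry of the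
  second moment matrix.\<close>

lemma inner_n_square:
  "(inner_n n x y)\<^sup>2 = (\<Sum>i<n. \<Sum>j<n. (x i * x j) * (y i * y j))"
  unfolding inner_n_def power2_eq_square sum_product by (simp add: algebra_simps)

text \<open>
  For the second moment matrix \<open>m\<close> of \<open>P\<close> restricted to a finite set, the squared Frobenius norm
  is a truncation of \<open>E[\<langle>X, X'\<rangle>\<^sup>2]\<close>. So the diagonal entries stay bounded as the set grows.
\<close>

lemma integrable_second_moment:
  assumes ov: "integrable (measure_pmf (pair_pmf P P)) (\<lambda>(x, y). (inner_n n x y)\<^sup>2)" and "i < n"
  shows "integrable (measure_pmf P) (\<lambda>x. (x i)\<^sup>2)"
  unfolding integrable_measure_pmf_iff_abs_summable
proof (rule abs_summable_finite_sumsI)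
  define E where "E = measure_pmf.expectation (pair_pmf P P) (\<lambda>(x, y). (inner_n n x y)\<^sup>2)"
  fix A :: "(nat \<Rightarrow> real) set" assume A: "finite A"
  define m where "m j k = (\<Sum>x\<in>A. pmf P x * (x j * x k))" for j k
  have "(m i i)\<^sup>2 \<le> (\<Sum>k<n. (m i k)\<^sup>2)"
    using \<open>i < n\<close> by (intro member_le_sum) auto
  also have "\<dots> \<le> (\<Sum>j<n. \<Sum>k<n. (m j k)\<^sup>2)"
    using \<open>i < n\<close> by (intro member_le_sum[where f = "\<lambda>j. \<Sum>k<n. (m j k)\<^sup>2"] sum_nonneg) auto
  also have "\<dots> = (\<Sum>j<n. \<Sum>k<n. \<Sum>(x, y)\<in>A \<times> A. pmf P x * pmf P y * ((x j * x k) * (y j * y k)))"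
    unfolding m_def power2_eq_square sum_product sum.cartesian_product
    by (intro sum.cong) (auto simp: algebra_simps)
  also have "\<dots> = (\<Sum>(x, y)\<in>A \<times> A. pmf P x * pmf P y * (inner_n n x y)\<^sup>2)"
    unfolding inner_n_square sum_distrib_left case_prod_unfold
    by (subst sum.swap[of _ _ "A \<times> A"], subst sum.swap[of _ _ "A \<times> A"]) simp
  also have "\<dots> = (\<Sum>z\<in>A \<times> A. (case z of (x, y) \<Rightarrow> (inner_n n x y)\<^sup>2) * pmf (pair_pmf P P) z)"
    by (intro sum.cong) (auto simp: pmf_pair)
  also have "\<dots> = measure_pmf.expectation (pair_pmf P P)
      (\<lambda>z. indicator (A \<times> A) z * (case z of (x, y) \<Rightarrow> (inner_n n x y)\<^sup>2))"
    by (subst integral_measure_pmf_real[where A = "A \<times> A"]) (use A in \<open>auto intro!: sum.cong split: split_indicator_asm\<close>)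
  also have "\<dots> \<le> E" unfolding E_def
    by (intro integral_mono integrable_real_mult_indicator[OF _ ov, unfolded mult.commute[of _ "indicator _ _"]] ov) (auto split: split_indicator)
  \<comment> \<open>The bound does not depend on \<open>A\<close>, and \<open>m i i\<close> is
    exactly the partial sum to be controlled.\<close>
  finally have "\<bar>m i i\<bar> \<le> sqrt E"
    using real_le_rsqrt[of "\<bar>m i i\<bar>" E] by simp
  then show "(\<Sum>x\<in>A. norm (pmf P x * (x i)\<^sup>2)) \<le> sqrt E"
    by (simp add: m_def power2_eq_square)
qed

text \<open>Cut the line at the levels \<open>K * m powr \<kappa>\<close>. On each shell the square
  is at most a polynomially growing weight \<open>w m\<close>, while the tail beyond the m-th level
  has mass at most \<open>exp (- m)\<close>, so the weighted sum converges.\<close>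

lemma integrable_square_of_stretched_exp_tail:
  fixes Q :: "real pmf" and K \<kappa> :: real
  assumes "K > 0" "\<kappa> > 0"
    and tail: "\<And>d. d > 0 \<Longrightarrow> measure_pmf.prob Q {t. \<bar>t\<bar> > K * d powr \<kappa>} \<le> exp (- d)"
  shows "integrable (measure_pmf Q) (\<lambda>t. t\<^sup>2)"
proof -
  define A where "A m = {t::real. \<bar>t\<bar> > K * real m powr \<kappa>}" for m
  define w where "w m = (K * real (Suc m) powr \<kappa>)\<^sup>2" for m
  have w0: "w m \<ge> 0" for m by (simp add: w_def)
  \<comment> \<open>At \<open>m = 0\<close>, outside the range of the tail hypothesis, the bound is
    the trivial one by 1.\<close>
  have tail': "measure_pmf.prob Q (A m) \<le> exp (- real m)" for m
    using tail[of "real m"] by (cases "m = 0") (auto simp: A_def)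
  have bound: "ennreal (t\<^sup>2) \<le> (\<Sum>m. ennreal (w m) * indicator (A m) t)" for t
  proof (cases "t = 0")
    case False
    have ex: "\<exists>m. \<bar>t\<bar> \<le> K * real (Suc m) powr \<kappa>"
    proof -
      have "filterlim (\<lambda>m. K * real (Suc m) powr \<kappa>) at_top sequentially"
        using assms(1,2) by real_asymp
      then have "\<forall>\<^sub>F m in sequentially. \<bar>t\<bar> \<le> K * real (Suc m) powr \<kappa>"
        unfolding filterlim_at_top by blast
      then show ?thesis
        by (rule eventually_happens'[OF sequentially_bot])
    qed
    \<comment> \<open>By minimality \<open>\<bar>t\<bar>\<close> lies above the m-th level and at
      most at the next one, so the single term with index \<open>m\<close> dominates. For
      \<open>m = 0\<close> the lower level is 0, which is why \<open>t = 0\<close> is treated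
      separately.\<close>
    define m where "m = (LEAST m. \<bar>t\<bar> \<le> K * real (Suc m) powr \<kappa>)"
    have le: "\<bar>t\<bar> \<le> K * real (Suc m) powr \<kappa>" unfolding m_def using ex by (rule LeastI_ex)
    have "t \<in> A m"
    proof (cases m)
      case 0 then show ?thesis using False \<open>\<kappa> > 0\<close> by (simp add: A_def)
    next
      case (Suc k)
      then have "\<not> \<bar>t\<bar> \<le> K * real (Suc k) powr \<kappa>" unfolding m_def by (metis lessI not_less_Least)
      then show ?thesis using Suc by (simp add: A_def)
    qed
    moreover have "t\<^sup>2 \<le> w m" using power_mono[OF le, of 2] by (simp add: w_def)
    ultimately have "ennreal (t\<^sup>2) \<le> ennreal (w m) * indicator (A m) t" by (simp add: ennreal_leI)
    also have "\<dots> \<le> (\<Sum>m. ennreal (w m) * indicator (A m) t)"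
      using sum_le_suminf[OF summableI, of "{m}" "\<lambda>m. ennreal (w m) * indicator (A m) t"]
      by (simp del: sum_mult_indicator)
    finally show ?thesis .
  qed simp
  have summ: "summable (\<lambda>m. w m * exp (- real m))"
  proof (rule summable_comparison_test_bigo)
    show "summable (\<lambda>m. norm (1 / real m ^ 2))" using inverse_power_summable[of 2, where 'a = real] by (simp add: field_simps)
    show "(\<lambda>m. w m * exp (- real m)) \<in> O(\<lambda>m. 1 / real m ^ 2)"
      unfolding w_def using \<open>K > 0\<close> \<open>\<kappa> > 0\<close> by real_asymp
  qed
  show ?thesis
  proof (rule integrableI_bounded)
    have "(\<integral>\<^sup>+t. ennreal (norm (t\<^sup>2)) \<partial>Q) \<le> (\<integral>\<^sup>+t. (\<Sum>m. ennreal (w m) * indicator (A m) t) \<partial>Q)"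
      using bound by (intro nn_integral_mono) simp
    also have "\<dots> = (\<Sum>m. ennreal (w m) * emeasure Q (A m))"
      by (simp add: nn_integral_suminf nn_integral_cmult)
    also have "\<dots> \<le> (\<Sum>m. ennreal (w m * exp (- real m)))"
      using tail' w0 by (intro suminf_le summableI)
        (auto simp: measure_pmf.emeasure_eq_measure ennreal_mult[symmetric] intro!: ennreal_leI mult_left_mono)
    also have "\<dots> = ennreal (\<Sum>m. w m * exp (- real m))"
      using summ w0 by (intro suminf_ennreal2) auto
    also have "\<dots> < \<infinity>" by simp
    finally show "(\<integral>\<^sup>+t. ennreal (norm (t\<^sup>2)) \<partial>Q) < \<infinity>" .
  qed simp
qed

section \<open>Tail probabilities above and below the overlap quantile\<close>

lemma overlap_quantile_upper:
  assumes "d > 0" "y > overlap_quantile n P d"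
  shows "measure_pmf.prob (overlap_pmf n P) {t. \<bar>t\<bar> > y} \<le> exp (- d)"
proof -
  let ?Q = "overlap_pmf n P"
  let ?S = "{y. measure_pmf.prob ?Q {t. \<bar>t\<bar> \<le> y} \<ge> 1 - exp (- d)}"
  \<comment> \<open>The infimum of an empty set would say nothing about its members. Here the masses
    of growing intervals tend to 1, which exceeds \<open>1 - exp (- d)\<close>.\<close>
  have ne: "?S \<noteq> {}"
  proof -
    have "(\<lambda>m. measure_pmf.prob ?Q {t. \<bar>t\<bar> \<le> real m}) \<longlonglongrightarrow> measure_pmf.prob ?Q (\<Union>m. {t. \<bar>t\<bar> \<le> real m})"
      by (rule measure_pmf.finite_Lim_measure_incseq) (auto simp: incseq_def)
    also have "(\<Union>m. {t::real. \<bar>t\<bar> \<le> real m}) = UNIV" using real_arch_simple by auto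
    finally have "(\<lambda>m. measure_pmf.prob ?Q {t. \<bar>t\<bar> \<le> real m}) \<longlonglongrightarrow> 1" by simp
    from order_tendstoD(1)[OF this, of "1 - exp (- d)"]
    obtain m where "1 - exp (- d) < measure_pmf.prob ?Q {t. \<bar>t\<bar> \<le> real m}"
      by (auto simp: eventually_sequentially)
    then show ?thesis by (auto intro!: exI[of _ "real m"])
  qed
  obtain s where s: "s \<in> ?S" "s < y"
    using assms(2) cInf_lessD[OF ne] unfolding overlap_quantile_def by blast
  have "1 - exp (- d) \<le> measure_pmf.prob ?Q {t. \<bar>t\<bar> \<le> s}" using s by simp
  also have "\<dots> \<le> measure_pmf.prob ?Q {t. \<bar>t\<bar> \<le> y}"
    using s by (intro measure_pmf.finite_measure_mono) auto
  also have "\<dots> = 1 - measure_pmf.prob ?Q {t. \<bar>t\<bar> > y}"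
    by (subst measure_pmf.prob_compl[symmetric]) (auto intro!: arg_cong[where f = "measure_pmf.prob ?Q"])
  finally show ?thesis by simp
qed

lemma overlap_quantile_lower:
  assumes "d > 0" "y < overlap_quantile n P d"
  shows "measure_pmf.prob (overlap_pmf n P) {t. \<bar>t\<bar> > y} \<ge> exp (- d)"
proof -
  let ?Q = "overlap_pmf n P"
  let ?S = "{y. measure_pmf.prob ?Q {t. \<bar>t\<bar> \<le> y} \<ge> 1 - exp (- d)}"
  \<comment> \<open>A negative level gives the empty event, whose mass 0 is below
    \<open>1 - exp (- d)\<close> because \<open>d > 0\<close>.\<close>
  have "bdd_below ?S"
  proof (rule bdd_belowI[of _ 0], rule ccontr)
    fix s assume "s \<in> ?S" "\<not> 0 \<le> s"
    then have "{t::real. \<bar>t\<bar> \<le> s} = {}" by auto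
    with \<open>s \<in> ?S\<close> \<open>d > 0\<close> show False by simp
  qed
  then have "y \<notin> ?S"
    using assms(2) cInf_lower[of y ?S] unfolding overlap_quantile_def by linarith
  then have "1 - exp (- d) \<ge> measure_pmf.prob ?Q {t. \<bar>t\<bar> \<le> y}" by simp
  also have "measure_pmf.prob ?Q {t. \<bar>t\<bar> \<le> y} = 1 - measure_pmf.prob ?Q {t. \<bar>t\<bar> > y}"
    by (subst measure_pmf.prob_compl[symmetric]) (auto intro!: arg_cong[where f = "measure_pmf.prob ?Q"])
  finally show ?thesis by simp
qed

subsection \<open>Moments of the standard Gaussian\<close>

lemma std_normal_distribution_moments:
  shows "integrable std_normal_distribution (\<lambda>x. x)" "(\<integral>x. x \<partial>std_normal_distribution) = 0"
    and "integrable std_normal_distribution (\<lambda>x. x\<^sup>2)" "(\<integral>x. x\<^sup>2 \<partial>std_normal_distribution) = 1"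
proof -
  show "integrable std_normal_distribution (\<lambda>x. x)" "integrable std_normal_distribution (\<lambda>x. x\<^sup>2)"
    using integrable_std_normal_distribution_moment[of 1] integrable_std_normal_distribution_moment[of 2] by (simp_all only: power_one_right)
  show "(\<integral>x. x \<partial>std_normal_distribution) = 0"
    using integral_std_normal_distribution_moment_odd[of 1] by (simp only: power_one_right odd_one simp_thms)
  have "fact (2 * 1) / (2 ^ 1 * fact 1) = (1::real)" by (simp add: fact_numeral)
  then show "(\<integral>x. x\<^sup>2 \<partial>std_normal_distribution) = 1"
    using std_normal_distribution_even_moments(1)[of 1] by (simp only: mult_1_right)
qed

lemma prob_space_std_gaussian: "prob_space (std_gaussian n)"
  unfolding std_gaussian_def
  by (rule prob_space_PiM) (rule prob_space_normal_density, simp)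

lemma std_gaussian_component:
  fixes f :: "real \<Rightarrow> real"
  assumes "i < n" and [measurable]: "f \<in> borel_measurable borel"
  shows "integrable (std_gaussian n) (\<lambda>z. f (z i)) \<longleftrightarrow> integrable std_normal_distribution f"
    and "(\<integral>z. f (z i) \<partial>std_gaussian n) = (\<integral>x. f x \<partial>std_normal_distribution)"
proof -
  have d: "distr (std_gaussian n) std_normal_distribution (\<lambda>z. z i) = std_normal_distribution"
    unfolding std_gaussian_def using \<open>i < n\<close>
    by (intro distr_PiM_component prob_space_normal_density) auto
  have m [measurable]: "(\<lambda>z. z i) \<in> measurable (std_gaussian n) std_normal_distribution"
    unfolding std_gaussian_def using \<open>i < n\<close> by (intro measurable_component_singleton) auto
  have f: "f \<in> borel_measurable std_normal_distribution" by simp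
  show "integrable (std_gaussian n) (\<lambda>z. f (z i)) \<longleftrightarrow> integrable std_normal_distribution f"
    using integrable_distr_eq[OF m f] by (simp add: d)
  show "(\<integral>z. f (z i) \<partial>std_gaussian n) = (\<integral>x. f x \<partial>std_normal_distribution)"
    using integral_distr[OF m f] by (simp add: d)
qed

lemma std_gaussian_covariance:
  assumes "i < n" "j < n"
  shows "integrable (std_gaussian n) (\<lambda>z. z i * z j)"
    and "(\<integral>z. z i * z j \<partial>std_gaussian n) = (if i = j then 1 else 0)"
proof -
  have "integrable (std_gaussian n) (\<lambda>z. z i * z j) \<and>
     (\<integral>z. z i * z j \<partial>std_gaussian n) = (if i = j then 1 else 0)"
  proof (cases "i = j")
    case True
    have "(\<lambda>x::real. x\<^sup>2) \<in> borel_measurable borel" by simp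
    note sq = std_gaussian_component[OF \<open>i < n\<close> this]
    have "integrable (std_gaussian n) (\<lambda>z. (z i)\<^sup>2)"
      using sq(1) std_normal_distribution_moments(3) by (rule iffD2)
    moreover have "(\<integral>z. (z i)\<^sup>2 \<partial>std_gaussian n) = 1"
      using sq(2) std_normal_distribution_moments(4) by (rule trans)
    ultimately show ?thesis
      unfolding True[symmetric] power2_eq_square by (simp only: if_True simp_thms)
  next
    case False
    interpret product_sigma_finite "\<lambda>_::nat. std_normal_distribution"
      unfolding product_sigma_finite_def
      by (rule allI, rule prob_space_imp_sigma_finite, rule prob_space_normal_density, simp)
    \<comment> \<open>Padding with the constant 1 writes \<open>z i * z j\<close> as a product over
      all coordinates, so its integral is the product of the coordinate integrals; the factor at
      \<open>i\<close> is 0.\<close>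
    define f :: "nat \<Rightarrow> real \<Rightarrow> real" where "f k x = (if k = i \<or> k = j then x else 1)" for k x
    interpret N: prob_space std_normal_distribution by (rule prob_space_normal_density) simp
    have f: "integrable std_normal_distribution (f k)" for k
    proof (cases "k = i \<or> k = j")
      case True
      then have "f k = (\<lambda>x. x)" by (auto simp: f_def)
      then show ?thesis using std_normal_distribution_moments(1) by (simp only:)
    next
      case False
      then have "f k = (\<lambda>x. 1)" by (auto simp: f_def)
      then show ?thesis by simp
    qed
    have prod: "(\<Prod>k<n. f k (z k)) = z i * z j" for z
    proof -
      have "(\<Prod>k<n. f k (z k)) = (\<Prod>k\<in>{i, j}. f k (z k))"
        by (rule prod.mono_neutral_right) (use assms in \<open>auto simp: f_def\<close>)
      then show ?thesis using False by (simp add: f_def)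
    qed
    have "(\<Prod>k<n. integral\<^sup>L std_normal_distribution (f k)) = 0"
    proof (rule prod_zero[OF finite_lessThan], rule bexI)
      have "f i = (\<lambda>x. x)" by (auto simp: f_def)
      then show "integral\<^sup>L std_normal_distribution (f i) = 0" using std_normal_distribution_moments(2) by (simp only:)
      show "i \<in> {..<n}" using assms by simp
    qed
    then show ?thesis
      using product_integrable_prod[of "{..<n}" f, OF finite_lessThan f]
        product_integral_prod[of "{..<n}" f, OF finite_lessThan f] False
      unfolding prod std_gaussian_def by (simp only: if_False simp_thms)
  qed
  then show "integrable (std_gaussian n) (\<lambda>z. z i * z j)"
    and "(\<integral>z. z i * z j \<partial>std_gaussian n) = (if i = j then 1 else 0)" by blast+
qed

lemma std_gaussian_linear:
  fixes v :: "nat \<Rightarrow> real"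
  shows "integrable (std_gaussian n) (\<lambda>z. \<Sum>j<n. v j * z j)"
    and "(\<integral>z. (\<Sum>j<n. v j * z j) \<partial>std_gaussian n) = 0"
    and "integrable (std_gaussian n) (\<lambda>z. (\<Sum>j<n. v j * z j)\<^sup>2)"
    and "(\<integral>z. (\<Sum>j<n. v j * z j)\<^sup>2 \<partial>std_gaussian n) = (\<Sum>j<n. (v j)\<^sup>2)"
proof -
  have i: "integrable (std_gaussian n) (\<lambda>z. z j)" "(\<integral>z. z j \<partial>std_gaussian n) = 0" if "j < n" for j
  proof -
    have "(\<lambda>x::real. x) \<in> borel_measurable borel" by simp
    note id = std_gaussian_component[OF that this]
    show "integrable (std_gaussian n) (\<lambda>z. z j)" "(\<integral>z. z j \<partial>std_gaussian n) = 0"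
      unfolding id using std_normal_distribution_moments(1,2) by blast+
  qed
  show "integrable (std_gaussian n) (\<lambda>z. \<Sum>j<n. v j * z j)"
    using i(1) by (rule integral_linear_form)
  show "(\<integral>z. (\<Sum>j<n. v j * z j) \<partial>std_gaussian n) = 0"
    using integral_linear_form(2)[of n "std_gaussian n" "\<lambda>j z. z j" v] i by simp
  show "integrable (std_gaussian n) (\<lambda>z. (\<Sum>j<n. v j * z j)\<^sup>2)"
    using std_gaussian_covariance(1) by (rule integral_quadratic_form)
  have "(\<integral>z. (\<Sum>j<n. v j * z j)\<^sup>2 \<partial>std_gaussian n)
      = (\<Sum>j<n. \<Sum>k<n. v j * v k * (\<integral>z. z j * z k \<partial>std_gaussian n))"
    using std_gaussian_covariance(1) by (rule integral_quadratic_form)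
  also have "\<dots> = (\<Sum>j<n. \<Sum>k<n. v j * v k * (if j = k then 1 else 0))"
    using std_gaussian_covariance(2) by (intro sum.cong refl) simp
  also have "\<dots> = (\<Sum>j<n. (v j)\<^sup>2)"
    by (simp add: power2_eq_square if_distrib cong: if_cong)
  finally show "(\<integral>z. (\<Sum>j<n. v j * z j)\<^sup>2 \<partial>std_gaussian n) = (\<Sum>j<n. (v j)\<^sup>2)" .
qed

subsection \<open>Linear estimators\<close>

text \<open>Provides the normalised test polynomial for those coordinates where a linear form cannot
  be normalised.\<close>

lemma const_one_in_poly_le: "(\<lambda>y. 1) \<in> poly_le n d"
proof -
  let ?e = "\<lambda>i\<in>{..<n}. 0::nat"
  have "?e \<in> multi_indices n d" by (auto simp: multi_indices_def)
  moreover have "(if \<alpha> = ?e then 1 else 0) * (\<Prod>i<n. y i ^ \<alpha> i) = (if \<alpha> = ?e then 1 else 0)"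
    for \<alpha> and y :: "nat \<Rightarrow> real" by simp
  ultimately have "(\<Sum>\<alpha>\<in>multi_indices n d. (if \<alpha> = ?e then 1 else 0) * (\<Prod>i<n. y i ^ \<alpha> i)) = 1"
    for y :: "nat \<Rightarrow> real" by (simp only: sum.delta[OF finite_multi_indices] if_True)
  then show ?thesis unfolding poly_le_def by (intro image_eqI[of _ _ "\<lambda>\<alpha>. if \<alpha> = ?e then 1 else 0"]) auto
qed

lemma linear_form_in_poly_le:
  assumes "d \<ge> 1"
  shows "(\<lambda>y. \<Sum>j<n. v j * y j) \<in> poly_le n d"
proof -
  let ?e = "\<lambda>j. \<lambda>i\<in>{..<n}. if i = j then 1 else 0::nat"
  \<comment> \<open>Summing over \<open>j\<close> instead of looking up the \<open>j\<close> that
    belongs to \<alpha> avoids any appeal to injectivity of \<open>?e\<close>.\<close>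
  let ?coef = "\<lambda>\<alpha>. \<Sum>j<n. if \<alpha> = ?e j then v j else 0"
  have e: "?e j \<in> multi_indices n d" if "j < n" for j
    using that assms by (auto simp: multi_indices_def)
  have "(\<Sum>\<alpha>\<in>multi_indices n d. ?coef \<alpha> * (\<Prod>i<n. y i ^ \<alpha> i)) = (\<Sum>j<n. v j * y j)" for y :: "nat \<Rightarrow> real"
  proof -
    have "(\<Sum>\<alpha>\<in>multi_indices n d. ?coef \<alpha> * (\<Prod>i<n. y i ^ \<alpha> i))
        = (\<Sum>j<n. \<Sum>\<alpha>\<in>multi_indices n d. if \<alpha> = ?e j then v j * (\<Prod>i<n. y i ^ \<alpha> i) else 0)"
      unfolding sum_distrib_right by (subst sum.swap) (intro sum.cong, auto)
    also have "\<dots> = (\<Sum>j<n. v j * (\<Prod>i<n. y i ^ ?e j i))"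
      using e by (intro sum.cong) (auto simp: finite_multi_indices)
    also have "\<dots> = (\<Sum>j<n. v j * y j)"
    proof (intro sum.cong refl)
      fix j assume "j \<in> {..<n}"
      have "(\<Prod>i<n. y i ^ ?e j i) = (\<Prod>i<n. if i = j then y i else 1)"
        by (intro prod.cong) auto
      also have "\<dots> = y j" using \<open>j \<in> {..<n}\<close> by simp
      finally show "v j * (\<Prod>i<n. y i ^ ?e j i) = v j * y j" by simp
    qed
    finally show ?thesis .
  qed
  then show ?thesis
    unfolding poly_le_def by (intro image_eqI[of _ _ ?coef]) (rule ext, simp_all only: UNIV_I)
qed

text \<open>A polynomial inherits measurability from the coordinates of the observation;
  Cauchy-Schwarz in \<open>gam_corr_le\<close> needs it.\<close>

lemma measurable_poly_gam_obs:
  assumes "g \<in> poly_le n d"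
  shows "(\<lambda>(x, z). g (gam_obs n lam x z)) \<in> borel_measurable (measure_pmf P \<Otimes>\<^sub>M std_gaussian n)"
proof -
  obtain coef where g: "g = (\<lambda>y. \<Sum>\<alpha>\<in>multi_indices n d. coef \<alpha> * (\<Prod>i<n. y i ^ \<alpha> i))"
    using assms by (auto simp: poly_le_def)
  have "(\<lambda>w. gam_obs n lam (fst w) (snd w) i) \<in> borel_measurable (measure_pmf P \<Otimes>\<^sub>M std_gaussian n)"
    if "i < n" for i
  proof -
    have [measurable]: "(\<lambda>z. z i) \<in> borel_measurable (std_gaussian n)"
      unfolding std_gaussian_def using that measurable_component_singleton[of i "{..<n}"] by simp
    have [measurable]: "(\<lambda>x. x i) \<in> borel_measurable (measure_pmf P)" by simp
    show ?thesis using that unfolding gam_obs_def by simp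
  qed
  then show ?thesis
    unfolding g case_prod_unfold
    by (intro borel_measurable_sum borel_measurable_times borel_measurable_const
        borel_measurable_prod borel_measurable_power) auto
qed

definition second_moment :: "(nat \<Rightarrow> real) pmf \<Rightarrow> nat \<Rightarrow> nat \<Rightarrow> real" where
  "second_moment P i j = measure_pmf.expectation P (\<lambda>x. x i * x j)"

lemma gam_obs_linear:
  "(\<Sum>j<n. v j * gam_obs n lam x z j) = sqrt lam * (\<Sum>j<n. v j * x j) + (\<Sum>j<n. v j * z j)"
  by (simp add: gam_obs_def sum_distrib_left sum.distrib algebra_simps)

lemma pair_sigma_finite_gam: "pair_sigma_finite (measure_pmf P) (std_gaussian n)"
  by (intro pair_sigma_finite.intro prob_space_imp_sigma_finite prob_space_std_gaussian
      measure_pmf.prob_space_axioms)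

text \<open>Cauchy-Schwarz over index pairs: the left side is the entrywise inner product of the
  second moment matrix with the rank-one matrix of entries \<open>v j * v k\<close>, whose Frobenius
  norm is the squared norm of \<open>v\<close>.\<close>

lemma sum_second_moment_quadratic_form_le:
  "(\<Sum>j<n. \<Sum>k<n. v j * v k * second_moment P j k)
    \<le> (\<Sum>j<n. (v j)\<^sup>2) * sqrt (\<Sum>j<n. \<Sum>k<n. (second_moment P j k)\<^sup>2)"
proof -
  let ?m = "second_moment P"
  have "(\<Sum>j<n. \<Sum>k<n. v j * v k * ?m j k)\<^sup>2 = (\<Sum>(j, k)\<in>{..<n} \<times> {..<n}. v j * v k * ?m j k)\<^sup>2"
    by (simp add: sum.cartesian_product)
  also have "\<dots> \<le> (\<Sum>p\<in>{..<n} \<times> {..<n}. (v (fst p) * v (snd p))\<^sup>2)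
      * (\<Sum>p\<in>{..<n} \<times> {..<n}. (?m (fst p) (snd p))\<^sup>2)"
    unfolding case_prod_unfold by (rule Cauchy_Schwarz_ineq_sum)
  also have "\<dots> = (\<Sum>j<n. (v j)\<^sup>2)\<^sup>2 * (\<Sum>j<n. \<Sum>k<n. (?m j k)\<^sup>2)"
    unfolding power2_eq_square[of "sum _ _"] sum_product sum.cartesian_product
    by (simp add: case_prod_unfold power_mult_distrib)
  finally have "\<bar>\<Sum>j<n. \<Sum>k<n. v j * v k * ?m j k\<bar>
      \<le> sqrt ((\<Sum>j<n. (v j)\<^sup>2)\<^sup>2 * (\<Sum>j<n. \<Sum>k<n. (?m j k)\<^sup>2))"
    by (intro real_le_rsqrt) simp
  then show ?thesis by (simp add: real_sqrt_mult sum_nonneg)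
qed

section \<open>Correlation achieved by linear estimators when second moments are finite\<close>

context
  fixes n :: nat and P :: "(nat \<Rightarrow> real) pmf"
  assumes sq: "\<And>i. i < n \<Longrightarrow> integrable (measure_pmf P) (\<lambda>x. (x i)\<^sup>2)"
begin

lemma integrable_coord: "i < n \<Longrightarrow> integrable (measure_pmf P) (\<lambda>x. x i)"
  using integral_Cauchy_Schwarz(1)[of "\<lambda>x. x i" "measure_pmf P" "\<lambda>_. 1"] sq[of i] by simp

lemma integrable_coord_mult:
  "i < n \<Longrightarrow> j < n \<Longrightarrow> integrable (measure_pmf P) (\<lambda>x. x i * x j)"
  using integral_Cauchy_Schwarz(1)[of "\<lambda>x. x i" "measure_pmf P" "\<lambda>x. x j"] sq by simp

text \<open>Independence of the replicas factors each summand of \<open>inner_n_square\<close>. This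
  links the squared Frobenius norm to the law of the overlap.\<close>

lemma expectation_inner_n_square:
  "measure_pmf.expectation (pair_pmf P P) (\<lambda>(x, y). (inner_n n x y)\<^sup>2)
    = (\<Sum>i<n. \<Sum>j<n. (second_moment P i j)\<^sup>2)"
proof -
  note m = expectation_pair_pmf_mult[OF integrable_coord_mult integrable_coord_mult, unfolded case_prod_unfold]
  have "measure_pmf.expectation (pair_pmf P P) (\<lambda>(x, y). (inner_n n x y)\<^sup>2)
     = (\<Sum>i<n. \<Sum>j<n. measure_pmf.expectation (pair_pmf P P)
          (\<lambda>z. (fst z i * fst z j) * (snd z i * snd z j)))"
    unfolding inner_n_square case_prod_unfold
    by (subst Bochner_Integration.integral_sum, use m(1) in force)
      (intro sum.cong refl Bochner_Integration.integral_sum, use m(1) in force)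
  also have "\<dots> = (\<Sum>i<n. \<Sum>j<n. (second_moment P i j)\<^sup>2)"
    by (intro sum.cong refl) (simp add: m(2) second_moment_def power2_eq_square)
  finally show ?thesis .
qed

text \<open>The noise contributes nothing, being centred and independent of the signal.\<close>

lemma gam_expectation_linear_mult:
  assumes "i < n"
  shows "gam_expectation n P lam (\<lambda>x y. (\<Sum>j<n. v j * y j) * x i)
      = sqrt lam * (\<Sum>j<n. v j * second_moment P i j)"
proof -
  interpret G: prob_space "std_gaussian n" by (rule prob_space_std_gaussian)
  interpret pair_sigma_finite "measure_pmf P" "std_gaussian n" by (rule pair_sigma_finite_gam)
  let ?f = "\<lambda>x. sqrt lam * (\<Sum>j<n. v j * (x i * x j))" and ?L = "\<lambda>z. \<Sum>j<n. v j * z j"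
  have f: "integrable (measure_pmf P) ?f"
    using integrable_coord_mult[OF assms]
    by (intro Bochner_Integration.integrable_mult_right integral_linear_form)
  have c: "integrable (std_gaussian n) (\<lambda>z. 1::real)" by simp
  have Ef: "(\<integral>x. ?f x \<partial>measure_pmf P) = sqrt lam * (\<Sum>j<n. v j * second_moment P i j)"
    using integral_linear_form(2)[of n "measure_pmf P" "\<lambda>j x. x i * x j" v, OF integrable_coord_mult[OF assms]]
    by (simp add: second_moment_def)
  note i1 = integral_mult_prod[OF f c] and i2 = integral_mult_prod[OF integrable_coord[OF assms] std_gaussian_linear(1)[of n v]]
  \<comment> \<open>The integrand is split into products of a function of \<open>x\<close> and a
    function of \<open>z\<close>; the dummy factor 1 gives the pure signal term this shape.\<close>
  have "gam_expectation n P lam (\<lambda>x y. (\<Sum>j<n. v j * y j) * x i)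
      = (\<integral>w. (case w of (x, z) \<Rightarrow> ?f x * 1) + (case w of (x, z) \<Rightarrow> x i * ?L z)
           \<partial>(measure_pmf P \<Otimes>\<^sub>M std_gaussian n))"
    unfolding gam_expectation_def gam_obs_linear
    by (intro Bochner_Integration.integral_cong refl)
      (auto simp: algebra_simps sum_distrib_left)
  also have "\<dots> = sqrt lam * (\<Sum>j<n. v j * second_moment P i j)"
    unfolding Bochner_Integration.integral_add[OF i1(1) i2(1)] i1(2) i2(2) std_gaussian_linear(2) Ef
    by (simp add: G.prob_space)
  finally show ?thesis .
qed

text \<open>In the expanded square the cross term vanishes because the noise is centred, and the
  noise square contributes the squared norm of \<open>v\<close> by the identity covariance.
  Positivity of \<open>lam\<close> turns the square of \<open>sqrt lam\<close> into
  \<open>lam\<close>.\<close>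

lemma gam_expectation_linear_square:
  assumes "lam > 0"
  shows "gam_expectation n P lam (\<lambda>x y. (\<Sum>j<n. v j * y j)\<^sup>2)
      = lam * (\<Sum>j<n. \<Sum>k<n. v j * v k * second_moment P j k) + (\<Sum>j<n. (v j)\<^sup>2)"
proof -
  interpret G: prob_space "std_gaussian n" by (rule prob_space_std_gaussian)
  interpret pair_sigma_finite "measure_pmf P" "std_gaussian n" by (rule pair_sigma_finite_gam)
  let ?L = "\<lambda>z. \<Sum>j<n. v j * z j"
  have L2: "integrable (measure_pmf P) (\<lambda>x. lam * (?L x)\<^sup>2)"
    using integrable_coord_mult by (intro Bochner_Integration.integrable_mult_right integral_quadratic_form)
  have L1: "integrable (measure_pmf P) (\<lambda>x. 2 * sqrt lam * ?L x)"
    using integrable_coord by (intro Bochner_Integration.integrable_mult_right integral_linear_form)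
  have c: "integrable (std_gaussian n) (\<lambda>z. 1::real)" "integrable (measure_pmf P) (\<lambda>z. 1::real)"
    by simp_all
  note i1 = integral_mult_prod[OF L2 c(1)]
    and i2 = integral_mult_prod[OF L1 std_gaussian_linear(1)[of n v]]
    and i3 = integral_mult_prod[OF c(2) std_gaussian_linear(3)[of n v]]
  have "gam_expectation n P lam (\<lambda>x y. (\<Sum>j<n. v j * y j)\<^sup>2)
      = (\<integral>w. (case w of (x, z) \<Rightarrow> lam * (?L x)\<^sup>2 * 1)
           + (case w of (x, z) \<Rightarrow> 2 * sqrt lam * ?L x * ?L z)
           + (case w of (x, z) \<Rightarrow> 1 * (?L z)\<^sup>2) \<partial>(measure_pmf P \<Otimes>\<^sub>M std_gaussian n))"
    unfolding gam_expectation_def gam_obs_linear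
    using assms by (intro Bochner_Integration.integral_cong refl)
      (auto simp: power2_sum power_mult_distrib)
  also have "\<dots> = lam * (\<integral>x. (?L x)\<^sup>2 \<partial>measure_pmf P) + (\<Sum>j<n. (v j)\<^sup>2)"
    unfolding Bochner_Integration.integral_add[OF Bochner_Integration.integrable_add[OF i1(1) i2(1)] i3(1)]
      Bochner_Integration.integral_add[OF i1(1) i2(1)] i1(2) i2(2) i3(2) std_gaussian_linear(2,4)
    by (simp add: G.prob_space)
  also have "(\<integral>x. (?L x)\<^sup>2 \<partial>measure_pmf P) = (\<Sum>j<n. \<Sum>k<n. v j * v k * second_moment P j k)"
    unfolding second_moment_def using integrable_coord_mult by (rule integral_quadratic_form)
  finally show ?thesis .
qed

text \<open>Cauchy-Schwarz against a normalised \<open>g\<close>. The bound is uniform in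
  \<open>g\<close>, so the supremum in \<open>low_degree_corr\<close> is over a set bounded above
  and dominates each of its members.\<close>

lemma gam_corr_le:
  assumes "i < n" "g \<in> poly_le n d" "gam_expectation n P lam (\<lambda>x y. (g y)\<^sup>2) = 1"
  shows "(gam_expectation n P lam (\<lambda>x y. g y * x i))\<^sup>2
      \<le> measure_pmf.expectation P (\<lambda>x. (x i)\<^sup>2)"
proof -
  interpret G: prob_space "std_gaussian n" by (rule prob_space_std_gaussian)
  interpret pair_sigma_finite "measure_pmf P" "std_gaussian n" by (rule pair_sigma_finite_gam)
  let ?M = "measure_pmf P \<Otimes>\<^sub>M std_gaussian n"
  let ?g = "\<lambda>w. g (gam_obs n lam (fst w) (snd w))" and ?x = "\<lambda>w. fst w i"
  \<comment> \<open>A non-integrable function would have integral 0, not 1.\<close>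
  have "integrable ?M (\<lambda>w. (?g w)\<^sup>2)"
    using assms(3) not_integrable_integral_eq[of ?M "\<lambda>w. (?g w)\<^sup>2"]
    by (auto simp: gam_expectation_def case_prod_unfold)
  moreover have "integrable (std_gaussian n) (\<lambda>z. 1::real)" by simp
  note x2 = integral_mult_prod[OF sq[OF assms(1)] this, unfolded case_prod_unfold]
  have "?x \<in> borel_measurable ?M"
    by (rule measurable_compose[OF measurable_fst]) simp
  ultimately have "(\<integral>w. ?g w * ?x w \<partial>?M)\<^sup>2 \<le> (\<integral>w. (?g w)\<^sup>2 \<partial>?M) * (\<integral>w. (?x w)\<^sup>2 \<partial>?M)"
    using x2(1) measurable_poly_gam_obs[OF assms(2), of lam P]
    by (intro integral_Cauchy_Schwarz(2)) (auto simp: case_prod_unfold)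
  then show ?thesis
    using assms(3) x2(2) by (simp add: gam_expectation_def case_prod_unfold G.prob_space)
qed

text \<open>For coordinate \<open>i\<close> the test polynomial is the linear form with the i-th row
  of the second moment matrix as coefficients, normalised. It contributes at least
  \<open>lam * r i / (1 + lam * F)\<close>, and the squared row norms \<open>r i\<close> add up to
  the square of \<open>F\<close>.\<close>

lemma low_degree_corr_ge:
  assumes "lam > 0" "d \<ge> 1"
  defines "F \<equiv> sqrt (\<Sum>i<n. \<Sum>j<n. (second_moment P i j)\<^sup>2)"
  shows "(low_degree_corr n P d lam)\<^sup>2 \<ge> lam * F\<^sup>2 / (1 + lam * F)"
proof -
  define T where "T = {g \<in> poly_le n d. gam_expectation n P lam (\<lambda>x y. (g y)\<^sup>2) = 1}"
  define h where "h i g = (gam_expectation n P lam (\<lambda>x y. g y * x i))\<^sup>2" for i g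
  define r where "r i = (\<Sum>j<n. (second_moment P i j)\<^sup>2)" for i
  have F: "F \<ge> 0" "F\<^sup>2 = (\<Sum>i<n. r i)" by (auto simp: F_def r_def sum_nonneg)
  have r: "r i \<ge> 0" for i by (auto simp: r_def sum_nonneg)
  have den: "1 + lam * F > 0" using F assms(1) by (simp add: add_pos_nonneg)
  interpret G: prob_space "std_gaussian n" by (rule prob_space_std_gaussian)
  interpret pair_prob_space "measure_pmf P" "std_gaussian n"
    by (intro pair_prob_space.intro pair_sigma_finite_gam measure_pmf.prob_space_axioms G.prob_space_axioms)
  have bdd: "bdd_above (h i ` T)" if "i < n" for i
    unfolding h_def T_def using gam_corr_le[OF that, of _ d lam] by (intro bdd_aboveI2) auto
  have one: "(\<lambda>y. 1) \<in> T"
    by (simp add: T_def const_one_in_poly_le gam_expectation_def case_prod_unfold prob_space)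
  have bound: "\<exists>g\<in>T. lam * r i / (1 + lam * F) \<le> h i g" if "i < n" for i
  proof (cases "r i = 0")
    \<comment> \<open>A zero row gives no normalisable form, but the required bound is then
      0.\<close>
    case True
    then show ?thesis by (intro bexI[OF _ one]) (simp add: h_def)
  next
    case False
    with r[of i] have rpos: "r i > 0" by simp
    let ?m = "second_moment P i"
    define N where "N = gam_expectation n P lam (\<lambda>x y. (\<Sum>j<n. ?m j * y j)\<^sup>2)"
    \<comment> \<open>The quadratic form is the mean of a square, so the noise part
      \<open>r i\<close> alone already makes \<open>N\<close> positive.\<close>
    have pos: "0 \<le> (\<Sum>j<n. \<Sum>k<n. ?m j * ?m k * second_moment P j k)"
    proof -
      have "0 \<le> measure_pmf.expectation P (\<lambda>x. (\<Sum>j<n. ?m j * x j)\<^sup>2)" by simp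
      also have "\<dots> = (\<Sum>j<n. \<Sum>k<n. ?m j * ?m k * measure_pmf.expectation P (\<lambda>x. x j * x k))"
        using integrable_coord_mult by (rule integral_quadratic_form)
      finally show ?thesis by (simp only: second_moment_def)
    qed
    have N: "N = lam * (\<Sum>j<n. \<Sum>k<n. ?m j * ?m k * second_moment P j k) + r i"
      unfolding N_def gam_expectation_linear_square[OF assms(1)] r_def ..
    have "N > 0" using pos rpos assms(1) unfolding N by (simp add: add_nonneg_pos)
    have "N \<le> r i * (1 + lam * F)"
      using mult_left_mono[OF sum_second_moment_quadratic_form_le[of ?m], of lam] assms(1)
      unfolding N F_def r_def by (simp add: algebra_simps)
    let ?g = "\<lambda>y. \<Sum>j<n. ?m j / sqrt N * y j"
    have g: "?g y = (\<Sum>j<n. ?m j * y j) / sqrt N" for y by (simp add: sum_divide_distrib)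
    have div: "gam_expectation n P lam (\<lambda>x y. h y / b) = gam_expectation n P lam (\<lambda>x y. h y) / b"
      for h and b :: real
      unfolding gam_expectation_def case_prod_unfold by simp
    have "gam_expectation n P lam (\<lambda>x y. (?g y)\<^sup>2) = N / (sqrt N)\<^sup>2"
      unfolding g power_divide div by (simp only: N_def)
    also have "\<dots> = 1" using \<open>N > 0\<close> by simp
    finally have "?g \<in> T"
      unfolding T_def
      by (intro CollectI conjI linear_form_in_poly_le[OF assms(2)])
    moreover have "lam * r i / (1 + lam * F) \<le> h i ?g"
    proof -
      have "(\<Sum>j<n. ?m j / sqrt N * ?m j) = r i / sqrt N"
        by (simp add: r_def sum_divide_distrib power2_eq_square)
      then have "h i ?g = (sqrt lam * r i / sqrt N)\<^sup>2"
        unfolding h_def gam_expectation_linear_mult[OF that] by simp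
      also have "\<dots> = lam * (r i)\<^sup>2 / N"
        using assms(1) \<open>N > 0\<close> by (simp add: power_mult_distrib power_divide)
      \<comment> \<open>The upper bound on \<open>N\<close> carries a factor \<open>r i\<close>,
        which cancels one of the two in the numerator.\<close>
      also have "\<dots> \<ge> lam * (r i)\<^sup>2 / (r i * (1 + lam * F))"
        using \<open>N \<le> _\<close> \<open>N > 0\<close> assms(1) by (intro divide_left_mono) (auto intro: mult_pos_pos rpos den)
      also have "lam * (r i)\<^sup>2 / (r i * (1 + lam * F)) = lam * r i / (1 + lam * F)"
        using rpos by (simp add: power2_eq_square)
      finally show ?thesis .
    qed
    ultimately show ?thesis by blast
  qed
  have S: "lam * r i / (1 + lam * F) \<le> (SUP g\<in>T. h i g)" if i: "i < n" for i
    using bound[OF i] cSUP_upper[OF _ bdd[OF i]] by (meson order_trans)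
  have "lam * F\<^sup>2 / (1 + lam * F) = (\<Sum>i<n. lam * r i / (1 + lam * F))"
    by (simp add: F(2) sum_distrib_left sum_divide_distrib)
  also have "\<dots> \<le> (\<Sum>i<n. SUP g\<in>T. h i g)"
    using S by (intro sum_mono) auto
  also have "\<dots> = (low_degree_corr n P d lam)\<^sup>2"
  proof -
    \<comment> \<open>Squaring undoes the root in \<open>low_degree_corr\<close> only for a
      nonnegative sum.\<close>
    have "0 \<le> (SUP g\<in>T. h i g)" if "i < n" for i
      using S[OF that] r[of i] den assms(1) by (meson divide_nonneg_pos less_imp_le mult_nonneg_nonneg order_trans)
    then have "0 \<le> (\<Sum>i<n. SUP g\<in>T. h i g)" by (intro sum_nonneg) auto
    then show ?thesis by (simp add: low_degree_corr_def T_def h_def)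
  qed
  finally show ?thesis .
qed

end

section \<open>From quantile bounds on the overlap to a lower bound on the correlation\<close>

lemma expectation_overlap_square:
  "measure_pmf.expectation (overlap_pmf n P) (\<lambda>t. t\<^sup>2)
    = measure_pmf.expectation (pair_pmf P P) (\<lambda>(x, y). (inner_n n x y)\<^sup>2)"
  by (simp add: overlap_pmf_def case_prod_unfold)

lemma integrable_overlap_square:
  "integrable (measure_pmf (overlap_pmf n P)) (\<lambda>t. t\<^sup>2)
    \<longleftrightarrow> integrable (measure_pmf (pair_pmf P P)) (\<lambda>(x, y). (inner_n n x y)\<^sup>2)"
  by (simp add: overlap_pmf_def case_prod_unfold)

text \<open>Written as \<open>y / (1 + 1 / (k * y))\<close>, the expression is visibly increasing in
  both variables. This allows lower bounds to replace the Frobenius norm and the SNR.\<close>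

lemma square_over_affine_mono:
  fixes l l' x x' :: real
  assumes "0 < l" "l \<le> l'" "0 < x" "x \<le> x'"
  shows "l * x\<^sup>2 / (1 + l * x) \<le> l' * x'\<^sup>2 / (1 + l' * x')"
proof -
  have eq: "k * y\<^sup>2 / (1 + k * y) = y / (1 + 1 / (k * y))" if "k > 0" "y > 0" for k y :: real
    using that by (simp add: field_simps power2_eq_square)
  have pos: "0 < l'" "0 < x'" "0 < l * x" "0 < l' * x'" using assms by auto
  have "1 / (l' * x') \<le> 1 / (l * x)"
    using assms pos by (intro divide_left_mono mult_mono) auto
  then have "x / (1 + 1 / (l * x)) \<le> x' / (1 + 1 / (l' * x'))"
    using assms pos by (intro frac_le) (auto intro: add_pos_pos)
  then show ?thesis using assms pos by (simp add: eq)
qed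

text \<open>The upper quantile bounds give a stretched exponential tail, hence finite second
  moments; the lower bound at level 1 keeps the overlap away from 0 with constant probability, so
  the Frobenius norm is at least \<open>G\<close>.\<close>

lemma low_degree_corr_lower_bound:
  fixes b K \<kappa> c1 :: real
  assumes "b > 0" "\<kappa> > 0" "c1 > 0" "c2 > 0"
    and quant: "\<And>t. t > 0 \<Longrightarrow> c1 * b * t powr \<kappa> \<le> overlap_quantile n P t
                  \<and> overlap_quantile n P t \<le> c2 * b * t powr \<kappa>"
    and "d \<ge> 1" "lam > 0"
  defines "G \<equiv> c1 * b * exp (- 1 / 2) / 2"
  shows "(low_degree_corr n P d lam)\<^sup>2 \<ge> lam * G\<^sup>2 / (1 + lam * G)"
proof -
  let ?Q = "overlap_pmf n P"
  have int: "integrable (measure_pmf ?Q) (\<lambda>t. t\<^sup>2)"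
  proof (rule integrable_square_of_stretched_exp_tail[of "2 * c2 * b" \<kappa>])
    fix t :: real assume t: "t > 0"
    then have "c2 * b * t powr \<kappa> > 0" using assms by simp
    \<comment> \<open>The factor 2 gives the strict inequality that
      \<open>overlap_quantile_upper\<close> asks for.\<close>
    then have "overlap_quantile n P t < 2 * c2 * b * t powr \<kappa>" using quant[OF t] by linarith
    then show "measure_pmf.prob ?Q {s. 2 * c2 * b * t powr \<kappa> < \<bar>s\<bar>} \<le> exp (- t)"
      by (rule overlap_quantile_upper[OF t])
  qed (use assms in auto)
  define F where "F = sqrt (\<Sum>i<n. \<Sum>j<n. (second_moment P i j)\<^sup>2)"
  have sq: "integrable (measure_pmf P) (\<lambda>x. (x i)\<^sup>2)" if "i < n" for i
    using int that unfolding integrable_overlap_square by (rule integrable_second_moment)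
  have F2: "F\<^sup>2 = measure_pmf.expectation ?Q (\<lambda>t. t\<^sup>2)"
    using expectation_inner_n_square[of n P] sq
    by (simp add: expectation_overlap_square F_def sum_nonneg)
  \<comment> \<open>Halving gives the strict inequality that \<open>overlap_quantile_lower\<close>
    asks for.\<close>
  have "c1 * b / 2 < overlap_quantile n P 1" 
  proof -
    have "c1 * b / 2 < c1 * b" using assms(1,3) by simp
    also have "\<dots> \<le> overlap_quantile n P 1" using quant[of 1] by simp
    finally show ?thesis .
  qed
  \<comment> \<open>Mass at least \<open>exp (- 1)\<close> beyond this level bounds the second
    moment from below by Markov's inequality; the root of \<open>exp (- 1)\<close> is the factor
    \<open>exp (- 1 / 2)\<close> in \<open>G\<close>.\<close>
  then have p: "measure_pmf.prob ?Q {t. c1 * b / 2 < \<bar>t\<bar>} \<ge> exp (- 1)"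
    by (rule overlap_quantile_lower[OF zero_less_one])
  have "G\<^sup>2 = (c1 * b / 2)\<^sup>2 * exp (- 1)"
    by (simp add: G_def power_mult_distrib power_divide flip: exp_of_nat_mult)
  also have "\<dots> \<le> (c1 * b / 2)\<^sup>2 * measure_pmf.prob ?Q {t. c1 * b / 2 < \<bar>t\<bar>}"
    using p by (rule mult_left_mono) simp
  also have "\<dots> = measure_pmf.expectation ?Q (\<lambda>t. (c1 * b / 2)\<^sup>2 * indicator {t. c1 * b / 2 < \<bar>t\<bar>} t)"
    by simp
  also have "\<dots> \<le> measure_pmf.expectation ?Q (\<lambda>t. t\<^sup>2)"
  proof (rule integral_mono[OF _ int])
    show "integrable (measure_pmf ?Q) (\<lambda>t. (c1 * b / 2)\<^sup>2 * indicator {t. c1 * b / 2 < \<bar>t\<bar>} t)"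
      by (rule measure_pmf.integrable_const_bound[of _ "(c1 * b / 2)\<^sup>2"]) (auto split: split_indicator)
    fix t :: real
    have "(c1 * b / 2)\<^sup>2 \<le> t\<^sup>2" if "c1 * b / 2 < \<bar>t\<bar>"
      using that assms by (intro abs_le_square_iff[THEN iffD1]) auto
    then show "(c1 * b / 2)\<^sup>2 * indicator {t. c1 * b / 2 < \<bar>t\<bar>} t \<le> t\<^sup>2"
      by (auto split: split_indicator)
  qed
  finally have "G\<^sup>2 \<le> F\<^sup>2" unfolding F2 .
  moreover have "G > 0" "F \<ge> 0" using assms by (auto simp: G_def F_def sum_nonneg)
  ultimately have "G \<le> F" by (simp add: abs_le_square_iff[symmetric])
  have "lam * G\<^sup>2 / (1 + lam * G) \<le> lam * F\<^sup>2 / (1 + lam * F)"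
    using \<open>G > 0\<close> \<open>G \<le> F\<close> \<open>lam > 0\<close> by (intro square_over_affine_mono) auto
  also have "\<dots> \<le> (low_degree_corr n P d lam)\<^sup>2"
    unfolding F_def using sq assms(6,7) by (intro low_degree_corr_ge) auto
  finally show ?thesis .
qed

text \<open>Since the previous bound increases with the SNR, it suffices to evaluate it at the
  smallest SNR allowed. Both that value and the target are of order \<open>b / s\<close> with
  \<open>s = d powr \<kappa>\<close>.\<close>

lemma low_degree_corr_quantile_bound:
  fixes b \<kappa> c c1 c2 :: real and P :: "(nat \<Rightarrow> real) pmf"
  assumes "b > 0" "\<kappa> > 0" "c > 0" "c1 > 0" "c2 > 0"
    and quant: "\<And>t. t > 0 \<Longrightarrow> c1 * b * t powr \<kappa> \<le> overlap_quantile n P t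
                  \<and> overlap_quantile n P t \<le> c2 * b * t powr \<kappa>"
    and "d \<ge> 1" "lam \<ge> c / overlap_quantile n P (real d)"
  defines "g \<equiv> c1 * exp (- 1 / 2) / 2"
  shows "(low_degree_corr n P d lam)\<^sup>2
    \<ge> c * g\<^sup>2 / (c2 * (c2 + c * g)) / real d powr (2 * \<kappa>) * overlap_quantile n P (real d)"
proof -
  define s where "s = real d powr \<kappa>"
  define q where "q = overlap_quantile n P (real d)"
  have "d > 0" using assms(7) by simp
  have s: "s \<ge> 1" unfolding s_def using assms(2,7) by (intro ge_one_powr_ge_zero) auto
  have g: "g > 0" using assms(4) by (simp add: g_def)
  have q: "c1 * b * s \<le> q" "q \<le> c2 * b * s"
    using quant[of "real d"] \<open>d > 0\<close> by (auto simp: s_def q_def)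
  have "c1 * b * s > 0" using s assms(1-5) by simp
  with q have "q > 0" by linarith
  have den: "c2 * s + c * g > 0" "c2 + c * g > 0" using s g assms(1-5) by (simp_all add: add_pos_pos)
  \<comment> \<open>The upper bound on the quantile yields an explicit smallest SNR.\<close>
  have "c / (c2 * b * s) \<le> c / q"
    using q \<open>q > 0\<close> assms(1-5) s by (intro divide_left_mono) auto
  also have "\<dots> \<le> lam" using assms(8) by (simp add: q_def)
  finally have lam: "c / (c2 * b * s) \<le> lam" .
  have "c / (c2 * b * s) > 0" using s assms(1-5) by simp
  with lam have "lam > 0" by linarith
  have "c * g\<^sup>2 / (c2 * (c2 + c * g)) / real d powr (2 * \<kappa>) * q
      = c * g\<^sup>2 / (c2 * (c2 + c * g)) * (q / s\<^sup>2)"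
    by (simp add: s_def powr_powr mult.commute flip: powr_numeral)
  also have "\<dots> \<le> c * g\<^sup>2 / (c2 * (c2 + c * g)) * (c2 * b * s / s\<^sup>2)"
    using q g den assms(1-5) by (intro mult_left_mono divide_right_mono) auto
  also have "\<dots> = c * g\<^sup>2 * b / ((c2 + c * g) * s)"
    using s assms(1-5) by (simp add: power2_eq_square)
  \<comment> \<open>As \<open>d \<ge> 1\<close> gives \<open>s \<ge> 1\<close>, both terms of the
    denominator are at most multiples of \<open>s\<close>; this is the source of the factor
    \<open>c2 + c * g\<close> in the constant.\<close>
  also have "\<dots> \<le> c * g\<^sup>2 * b / (c2 * s + c * g)"
  proof (rule divide_left_mono)
    have "c * g * 1 \<le> c * g * s" using s g assms(1-5) by (intro mult_left_mono) auto
    then show "c2 * s + c * g \<le> (c2 + c * g) * s" by (simp add: algebra_simps)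
  qed (use s g den assms(1-5) in auto)
  \<comment> \<open>This is the linear estimator bound at SNR \<open>c / (c2 * b * s)\<close>, with
    \<open>b * g\<close> in the role of \<open>G\<close>.\<close>
  also have "\<dots> = c / (c2 * b * s) * (b * g)\<^sup>2 / (1 + c / (c2 * b * s) * (b * g))"
    using s g assms(1-5) den by (simp add: field_simps power2_eq_square)
  also have "\<dots> \<le> lam * (b * g)\<^sup>2 / (1 + lam * (b * g))"
    using lam g assms(1) \<open>c / (c2 * b * s) > 0\<close> by (intro square_over_affine_mono) auto
  also have "\<dots> \<le> (low_degree_corr n P d lam)\<^sup>2"
    using low_degree_corr_lower_bound[OF assms(1,2,4,5) quant assms(7) \<open>lam > 0\<close>]
    by (simp add: g_def mult_ac)
  finally show ?thesis by (simp add: q_def)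
qed

subsection \<open>The annealed Franz-Parisi potential\<close>

text \<open>The indicator leaves a single atom, and its mass is positive on \<open>S_ov\<close>, so
  the logarithm of the product splits.\<close>

lemma F_ann_eq:
  assumes "q \<in> S_ov n P"
  shows "F_ann n P lam q = - lam * q - ln (pmf (overlap_pmf n P) q)"
proof -
  have "measure_pmf.expectation (pair_pmf P P)
      (\<lambda>(x, x'). indicator {q} (inner_n n x x') * exp (lam * inner_n n x x'))
    = measure_pmf.expectation (overlap_pmf n P) (\<lambda>t. indicator {q} t * exp (lam * t))"
    unfolding overlap_pmf_def by (simp add: case_prod_unfold)
  also have "\<dots> = pmf (overlap_pmf n P) q * exp (lam * q)"
    by (subst integral_measure_pmf_real[where A = "{q}"]) (auto split: split_indicator_asm)
  finally show ?thesis
    using assms by (simp add: F_ann_def S_ov_def ln_mult)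
qed

text \<open>For any positive step the linear term has discrete derivative exactly
  \<open>- lam\<close>. Both endpoints must lie in \<open>S_ov\<close> for \<open>F_ann_eq\<close>
  to apply.\<close>

lemma discrete_deriv_F_ann:
  assumes "q \<in> S_ov n P" "a q > 0" "q + a q \<in> S_ov n P"
  shows "lam + discrete_deriv a (F_ann n P lam) q
    = - discrete_deriv a (\<lambda>t. ln (pmf (overlap_pmf n P) t)) q"
proof -
  let ?L = "\<lambda>t. ln (pmf (overlap_pmf n P) t)"
  have "F_ann n P lam (q + a q) - F_ann n P lam q = - (?L (q + a q) - ?L q) - lam * a q"
    unfolding F_ann_eq[OF assms(1)] F_ann_eq[OF assms(3)] by (simp add: algebra_simps)
  then have "discrete_deriv a (F_ann n P lam) q = (- (?L (q + a q) - ?L q) - lam * a q) / a q"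
    unfolding discrete_deriv_def by (rule arg_cong)
  also have "\<dots> = - discrete_deriv a ?L q - lam"
    unfolding discrete_deriv_def using assms(2) by (simp add: diff_divide_distrib)
  finally show ?thesis by simp
qed

theorem theorem2p13:
  fixes c c1 c2 C \<kappa> :: real
    and D :: "nat \<Rightarrow> nat"
    and B :: "nat \<Rightarrow> real"
    and P :: "nat \<Rightarrow> (nat \<Rightarrow> real) pmf"
    and a :: "nat \<Rightarrow> real \<Rightarrow> real"
  assumes "c > 0" "c1 > 0" "c2 > 0" "C > 0" "\<kappa> > 0"
    and "\<forall>n\<ge>1. D n > 0"
    and "(\<lambda>n. real (D n)) \<in> \<omega>(\<lambda>_. 1)"
    and "\<forall>n\<ge>1. B n > 0"
    and "B \<in> \<omega>(\<lambda>n. max (real n powr (- C)) (exp (- C * real (D n))))"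
    and "\<forall>n\<ge>1. set_pmf (P n) \<subseteq> Rn n"
    and "\<forall>n\<ge>1. \<forall>q\<in>S_ov n (P n). a n q > 0 \<and> q + a n q \<in> S_ov n (P n)"
    and "\<forall>n\<ge>1. \<forall>d>0. c1 * B n * d powr \<kappa> \<le> overlap_quantile n (P n) d
                    \<and> overlap_quantile n (P n) d \<le> c2 * B n * d powr \<kappa>"
    and "\<forall>n\<ge>1. overlap_quantile n (P n) (real (D n)) \<in> S_ov n (P n)"
    and "\<forall>n\<ge>1. discrete_deriv (a n) (\<lambda>t. ln (pmf (overlap_pmf n (P n)) t))
                   (overlap_quantile n (P n) (real (D n)))
                 \<le> - c / overlap_quantile n (P n) (real (D n))"
  shows "\<exists>C'>0.
     (\<forall>n\<ge>1. \<forall>u>0.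
        u + discrete_deriv (a n) (F_ann n (P n) u) (overlap_quantile n (P n) (real (D n))) > 0 \<longrightarrow>
        (low_degree_corr n (P n) (D n)
           (u + discrete_deriv (a n) (F_ann n (P n) u)
                  (overlap_quantile n (P n) (real (D n)))))\<^sup>2
        \<ge> C' / real (D n) powr (2 * \<kappa>) * overlap_quantile n (P n) (real (D n))) \<and>
     (\<forall>n\<ge>1. \<forall>lam>0.
        (low_degree_corr n (P n) (D n) lam)\<^sup>2
          \<le> C' / real (D n) powr (2 * \<kappa>) * overlap_quantile n (P n) (real (D n)) \<longrightarrow>
        discrete_deriv (a n) (F_ann n (P n) lam) (overlap_quantile n (P n) (real (D n))) \<ge> 0)"
proof -
  define q where "q n = overlap_quantile n (P n) (real (D n))" for n
  define K where "K = c * (c1 * exp (- 1 / 2) / 2)\<^sup>2 / (c2 * (c2 + c * (c1 * exp (- 1 / 2) / 2)))"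
  have "K > 0" unfolding K_def using assms(1-3) by (simp add: add_pos_pos)
  have q: "q n > 0" if "n \<ge> 1" for n
  proof -
    have "0 < c1 * B n * real (D n) powr \<kappa>" using that assms(2,6,8) by simp
    also have "\<dots> \<le> q n" using that assms(6,12) by (simp add: q_def)
    finally show ?thesis .
  qed
  have scaled_pos: "K / real (D n) powr (2 * \<kappa>) * q n > 0" if "n \<ge> 1" for n
    using \<open>K > 0\<close> q[OF that] that assms(6) by simp
  \<comment> \<open>The quantile bound holds with \<open>K\<close> and its right side is positive,
    so halving the constant makes it strict. The converse implication below is proved by
    contradiction from a non-strict premise and needs this, hence the witness
    \<open>K / 2\<close>.\<close>
  have corr: "(low_degree_corr n (P n) (D n) lam)\<^sup>2 > K / 2 / real (D n) powr (2 * \<kappa>) * q n"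
    if n: "n \<ge> 1" and lam: "lam \<ge> c / q n" for n lam
  proof -
    have "K / real (D n) powr (2 * \<kappa>) * q n \<le> (low_degree_corr n (P n) (D n) lam)\<^sup>2"
      unfolding K_def q_def
      using n lam[unfolded q_def] assms(6,8,12) assms(1-3,5)
      by (intro low_degree_corr_quantile_bound[of "B n"]) (auto simp: Suc_le_eq)
    then show ?thesis using scaled_pos[OF n] by simp
  qed
  \<comment> \<open>The shifted SNR is minus the discrete derivative of the log-mass, the same for
    all \<open>u\<close>, so the hypothesis on that derivative bounds it from below.\<close>
  have deriv: "u + discrete_deriv (a n) (F_ann n (P n) u) (q n) \<ge> c / q n" if "n \<ge> 1" for n u
  proof -
    have "u + discrete_deriv (a n) (F_ann n (P n) u) (q n)
        = - discrete_deriv (a n) (\<lambda>t. ln (pmf (overlap_pmf n (P n)) t)) (q n)"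
      using that assms(11,13) by (intro discrete_deriv_F_ann) (auto simp: q_def)
    moreover have "discrete_deriv (a n) (\<lambda>t. ln (pmf (overlap_pmf n (P n)) t)) (q n) \<le> - c / q n"
      using that assms(14) by (simp add: q_def)
    ultimately show ?thesis by simp
  qed
  show ?thesis
    unfolding q_def[symmetric]
  proof (intro exI[of _ "K / 2"] conjI allI impI)
    show "K / 2 > 0" using \<open>K > 0\<close> by simp
  next
    fix n u assume "n \<ge> (1::nat)"
    then show "K / 2 / real (D n) powr (2 * \<kappa>) * q n
        \<le> (low_degree_corr n (P n) (D n) (u + discrete_deriv (a n) (F_ann n (P n) u) (q n)))\<^sup>2"
      using corr[OF _ deriv] by (simp add: less_imp_le)
  next
    fix n lam
    assume n: "n \<ge> (1::nat)"
      and le: "(low_degree_corr n (P n) (D n) lam)\<^sup>2 \<le> K / 2 / real (D n) powr (2 * \<kappa>) * q n"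
    show "discrete_deriv (a n) (F_ann n (P n) lam) (q n) \<ge> 0"
    proof (rule ccontr)
      assume "\<not> ?thesis"
      \<comment> \<open>A negative derivative makes \<open>lam\<close> larger than the shifted SNR,
        so the strict correlation bound applies at \<open>lam\<close> itself and contradicts the
        premise.\<close>
      with deriv[OF n, of lam] have "lam \<ge> c / q n" by linarith
      from corr[OF n this] le show False by linarith
    qed
  qed
qed

end
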